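(* Let $\bar A\in\mathbb{R}^{m\times m}$, $\bar B\in\mathbb{R}^{m\times d}$, $C\in\mathbb{R}^{p\times m}$ define a linear state space model with impulse-response matrices $\mathcal{W}(\tau)=C\bar A^{\tau}\bar B\in\mathbb{R}^{p\times d}$, $\tau\ge 0$, and interaction rank $$k=\dim\big(\mathrm{span}\{\mathcal{W}(\tau):\tau\ge 0\}\big).$$ Fix a sequence length $n$ that is large enough that $$\mathrm{span}\{\mathcal{W}(0),\mathcal{W}(1),\dots,\mathcal{W}(n-1)\}=\mathrm{span}\{\mathcal{W}(\tau):\tau\ge 0\}.$$ (Necessity) If a multi-head factorized linear-attention model with $H$ heads (and some head dimension $r$) represents the state space model exactly on length-$n$ sequences, then $H\ge k$. (Sufficiency) Conversely, if $H\ge k$, then there exist value matrices $V^{(1)},\dots,V^{(H)}\in\mathbb{R}^{p\times d}$ and positional feature maps $\phi^{(h)},\psi^{(h)}:\{1,\dots,n\}\to\mathbb{R}^r$, $h=1,\dots,H$, with head dimension $r\le n$, such that the resulting multi-head factorized linear-attention model with $H$ heads represents the state space model exactly on length-$n$ sequences. Indeed, one may take $r=\max_{h\le k}\mathrm{rank}(A^{(h)})\le n$, where, for a basis $M_1,\dots,M_k$ of $\mathrm{span}\{\mathcal{W}(\tau):\tau\ge0\}$ and the unique scalars $c_{\tau,h}$ with $\mathcal{W}(\tau)=\sum_{h=1}^k c_{\tau,h}M_h$ ($0\le\tau\le n-1$), $A^{(h)}\in\mathbb{R}^{n\times n}$ is the lower-triangular matrix with $A^{(h)}_{ij}=c_{i-j,h}$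 for $i\ge j$ and $A^{(h)}_{ij}=0$ for $i<j$.
   Context: All sequences have length $n$, with tokens $\mathbf{x}_1,\dots,\mathbf{x}_n\in\mathbb{R}^d$. The causal input--output map of the state space model on length-$n$ sequences is $$\mathbf{y}_i=\sum_{j=1}^{i}\mathcal{W}(i-j)\,\mathbf{x}_j,\qquad i=1,\dots,n.$$ A multi-head factorized linear-attention model with $H$ heads, head dimension $r$, value matrices $V^{(h)}\in\mathbb{R}^{p\times d}$ and positional feature maps $\phi^{(h)},\psi^{(h)}:\{1,\dots,n\}\to\mathbb{R}^r$ ($h=1,\dots,H$) produces the outputs $$\hat{\mathbf{y}}_i=\sum_{j=1}^{n}\Big(\sum_{h=1}^{H}\alpha^{(h)}_{ij}V^{(h)}\Big)\mathbf{x}_j,\qquad \alpha^{(h)}_{ij}=\langle\phi^{(h)}(i),\psi^{(h)}(j)\rangle,\qquad i=1,\dots,n,$$ where causality is required: $\alpha^{(h)}_{ij}=0$ for all $j>i$ and all $h$. The model represents the state space model exactly on length-$n$ sequences if $\hat{\mathbf{y}}_i=\mathbf{y}_i$ for all $i=1,\dots,n$ and all inputs $(\mathbf{x}_1,\dots,\mathbf{x}_n)\in(\mathbb{R}^d)^n$. *)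

theory Defs
  imports "Jordan_Normal_Form.DL_Rank" "HOL-Analysis.Analysis"
begin

(* In HOL-Analysis the operations * and ^ on real^'m^'m act entrywise, so the power of a
   square matrix with respect to the matrix product ** is defined here. *)
primrec matrix_power :: "real ^ 'm ^ 'm \<Rightarrow> nat \<Rightarrow> real ^ 'm ^ 'm" where
  "matrix_power A 0 = Finite_Cartesian_Product.mat 1"
| "matrix_power A (Suc t) = A ** matrix_power A t"

definition impulse_response ::
  "real ^ 'm ^ 'm \<Rightarrow> real ^ 'd ^ 'm \<Rightarrow> real ^ 'm ^ 'p \<Rightarrow> nat \<Rightarrow> real ^ 'd ^ 'p" where
  "impulse_response A B C t = C ** matrix_power A t ** B"

definition interaction_rank :: "(nat \<Rightarrow> real ^ 'd ^ 'p) \<Rightarrow> nat" where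
  "interaction_rank W = dim (span (range W))"

(* Sequences x_1, ..., x_n are functions on nat of which only the values at 1, ..., n are used;
   likewise for heads, which are numbered 1, ..., H. *)
definition ssm_output ::
  "(nat \<Rightarrow> real ^ 'd ^ 'p) \<Rightarrow> (nat \<Rightarrow> real ^ 'd) \<Rightarrow> nat \<Rightarrow> real ^ 'p" where
  "ssm_output W x i = (\<Sum>j=1..i. W (i - j) *v x j)"

(* Feature maps have a head dimension r that varies inside the statements, so their values are
   vectors in carrier_vec r, with scalar_prod as inner product. *)
definition attention_weight ::
  "(nat \<Rightarrow> nat \<Rightarrow> real Matrix.vec) \<Rightarrow> (nat \<Rightarrow> nat \<Rightarrow> real Matrix.vec) \<Rightarrow> nat \<Rightarrow> nat \<Rightarrow> nat \<Rightarrow> real" where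
  "attention_weight \<phi> \<psi> h i j = scalar_prod (\<phi> h i) (\<psi> h j)"

definition causal_linear_attention ::
  "nat \<Rightarrow> nat \<Rightarrow> nat \<Rightarrow> (nat \<Rightarrow> nat \<Rightarrow> real Matrix.vec) \<Rightarrow> (nat \<Rightarrow> nat \<Rightarrow> real Matrix.vec) \<Rightarrow> bool" where
  "causal_linear_attention n H r \<phi> \<psi> \<longleftrightarrow>
     (\<forall>h\<in>{1..H}. \<forall>i\<in>{1..n}. \<phi> h i \<in> carrier_vec r \<and> \<psi> h i \<in> carrier_vec r) \<and>
     (\<forall>h\<in>{1..H}. \<forall>i\<in>{1..n}. \<forall>j\<in>{1..n}. i < j \<longrightarrow> attention_weight \<phi> \<psi> h i j = 0)"

definition attention_output ::
  "nat \<Rightarrow> nat \<Rightarrow> (nat \<Rightarrow> real ^ 'd ^ 'p) \<Rightarrow> (nat \<Rightarrow> nat \<Rightarrow> real Matrix.vec) \<Rightarrow> (nat \<Rightarrow> nat \<Rightarrow> real Matrix.vec) \<Rightarrow>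
   (nat \<Rightarrow> real ^ 'd) \<Rightarrow> nat \<Rightarrow> real ^ 'p" where
  "attention_output n H V \<phi> \<psi> x i =
     (\<Sum>j=1..n. (\<Sum>h=1..H. attention_weight \<phi> \<psi> h i j *\<^sub>R V h) *v x j)"

definition represents_ssm ::
  "nat \<Rightarrow> nat \<Rightarrow> nat \<Rightarrow> (nat \<Rightarrow> real ^ 'd ^ 'p) \<Rightarrow> (nat \<Rightarrow> nat \<Rightarrow> real Matrix.vec) \<Rightarrow>
   (nat \<Rightarrow> nat \<Rightarrow> real Matrix.vec) \<Rightarrow> (nat \<Rightarrow> real ^ 'd ^ 'p) \<Rightarrow> bool" where
  "represents_ssm n H r V \<phi> \<psi> W \<longleftrightarrow>
     causal_linear_attention n H r \<phi> \<psi> \<and>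
     (\<forall>x. \<forall>i\<in>{1..n}. attention_output n H V \<phi> \<psi> x i = ssm_output W x i)"

definition is_basis_of :: "nat \<Rightarrow> (nat \<Rightarrow> real ^ 'd ^ 'p) \<Rightarrow> (real ^ 'd ^ 'p) set \<Rightarrow> bool" where
  "is_basis_of k M S \<longleftrightarrow>
     inj_on M {1..k} \<and> independent (M ` {1..k}) \<and> span (M ` {1..k}) = S"

definition is_coordinates ::
  "nat \<Rightarrow> nat \<Rightarrow> (nat \<Rightarrow> real ^ 'd ^ 'p) \<Rightarrow> (nat \<Rightarrow> real ^ 'd ^ 'p) \<Rightarrow> (nat \<Rightarrow> nat \<Rightarrow> real) \<Rightarrow> bool"
  where
  "is_coordinates n k W M c \<longleftrightarrow> (\<forall>t<n. W t = (\<Sum>h=1..k. c t h *\<^sub>R M h))"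

lemma is_coordinates_exists:
  assumes "is_basis_of k M (span (range W))"
  shows "\<exists>c. is_coordinates n k W M c"
proof -
  have "W t = (\<Sum>h=1..k. representation (M ` {1..k}) (W t) (M h) *\<^sub>R M h)" for t
  proof -
    have "(\<Sum>v\<in>M ` {1..k}. representation (M ` {1..k}) (W t) v *\<^sub>R v) = W t"
      using assms unfolding is_basis_of_def
      by (intro real_vector.sum_representation_eq) (auto intro: span_base)
    then show ?thesis
      using assms unfolding is_basis_of_def by (simp add: sum.reindex)
  qed
  then show ?thesis
    unfolding is_coordinates_def
    by (intro exI[where x = "\<lambda>t h. representation (M ` {1..k}) (W t) (M h)"]) blast
qed

lemma is_coordinates_unique:
  assumes "is_basis_of k M S" "is_coordinates n k W M c" "is_coordinates n k W M c'"
    and "t < n" "h \<in> {1..k}"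
  shows "c t h = c' t h"
proof -
  let ?g = "\<lambda>v. c t (the_inv_into {1..k} M v) - c' t (the_inv_into {1..k} M v)"
  have inj: "inj_on M {1..k}" and ind: "independent (M ` {1..k})"
    using assms(1) unfolding is_basis_of_def by auto
  have "(\<Sum>v\<in>M ` {1..k}. ?g v *\<^sub>R v) = (\<Sum>h=1..k. (c t h - c' t h) *\<^sub>R M h)"
    using inj by (simp add: sum.reindex the_inv_into_f_f)
  also have "\<dots> = W t - W t"
    using assms(2-4) unfolding is_coordinates_def
    by (simp add: scaleR_left_diff_distrib sum_subtractf)
  finally have "(\<Sum>v\<in>M ` {1..k}. ?g v *\<^sub>R v) = 0" by simp
  then have "?g (M h) = 0"
    using real_vector.independentD[OF ind, of "M ` {1..k}" ?g "M h"] assms(5) by auto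
  then show ?thesis using inj assms(5) by (simp add: the_inv_into_f_f)
qed

(* Rows and columns of a mat are indexed from 0; the entries depend on i - j only, so this is
   the same matrix as with indices 1, ..., n. *)
definition coordinate_toeplitz :: "nat \<Rightarrow> (nat \<Rightarrow> nat \<Rightarrow> real) \<Rightarrow> nat \<Rightarrow> real Matrix.mat" where
  "coordinate_toeplitz n c h = Matrix.mat n n (\<lambda>(i, j). if j \<le> i then c (i - j) h else 0)"

(* The inserted 0 only fixes the value for k = 0 (all impulse-response matrices zero), where the
   maximum ranges over the empty set. *)
definition max_toeplitz_rank :: "nat \<Rightarrow> nat \<Rightarrow> (nat \<Rightarrow> nat \<Rightarrow> real) \<Rightarrow> nat" where
  "max_toeplitz_rank n k c =
     Max (insert 0 ((\<lambda>h. vec_space.rank n (coordinate_toeplitz n c h)) ` {1..k}))"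

end

theory Submission
  imports Defs
begin

text \<open>
  Feeding the model sequences supported on a single token identifies its kernel: exactness means
  \<open>\<W>(i - j) = \<Sum>\<^sub>h \<alpha>\<^sup>h\<^sub>i\<^sub>j V\<^sup>h\<close> for \<open>j \<le> i\<close>. Hence the \<open>H\<close> value matrices span all \<open>\<W>(t)\<close> with
  \<open>t < n\<close>, which forces \<open>k \<le> H\<close>. Conversely, taking a basis of the span as value matrices, the
  required weights form lower-triangular Toeplitz matrices of coordinates, and a factorization
  of each of them through its rank supplies the feature maps.
\<close>

text \<open>A maximal linearly independent set of columns works: its cardinality is the rank, and a
  column outside its span could be adjoined, against maximality.\<close>

lemma (in vec_space) rank_spanning_set:
  assumes "A \<in> carrier_mat n nc"
  obtains S where "S \<subseteq> set (cols A)" "card S = rank A" "set (cols A) \<subseteq> span S"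
proof -
  let ?C = "set (cols A)"
  have C: "?C \<subseteq> carrier_vec n" using assms cols_dim by blast
  have "lin_indpt {}"
    by (metis empty_subsetI finite.emptyI finite_lin_indpt2 empty_iff)
  then obtain S where max: "maximal S (\<lambda>T. T \<subseteq> ?C \<and> lin_indpt T)"
    using maximal_exists_superset[of ?C "\<lambda>T. T \<subseteq> ?C \<and> lin_indpt T" "{}"] by auto
  then have S: "S \<subseteq> ?C" "lin_indpt S" unfolding maximal_def by auto
  have "s \<in> span S" if s: "s \<in> ?C" for s
  proof (rule ccontr)
    assume ns: "s \<notin> span S"
    then have "s \<notin> S" using S C span_mem by auto
    moreover have "lin_indpt (S \<union> {s})"
      using lin_dep_iff_in_span[of S s] S C s ns \<open>s \<notin> S\<close> by auto
    ultimately show False using max S s unfolding maximal_def by auto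
  qed
  with S that rank_card_indpt[OF assms max] show thesis by auto
qed

text \<open>Expanding every column in a spanning set of \<open>rank A\<close> columns writes
  \<open>A\<close> as a product of two matrices with inner dimension \<open>rank A\<close>; padding
  with zeros reaches any larger \<open>r\<close>. The rows of the left factor and the columns of the
  right one serve later as feature maps.\<close>

lemma (in vec_space) rank_factorization:
  assumes A: "A \<in> carrier_mat n nc" and r: "rank A \<le> r"
  obtains f g where "\<And>i. f i \<in> carrier_vec r" "\<And>j. g j \<in> carrier_vec r"
    "\<And>i j. i < n \<Longrightarrow> j < nc \<Longrightarrow> scalar_prod (f i) (g j) = A $$ (i, j)"
proof -
  obtain S where S: "S \<subseteq> set (cols A)" "card S = rank A" "set (cols A) \<subseteq> span S"
    using rank_spanning_set[OF A] .
  have SC: "S \<subseteq> carrier_vec n" using S(1) A cols_dim by blast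
  have fin: "finite S" using S(1) finite_subset by blast
  obtain e where e: "bij_betw e {..<card S} S"
    using ex_bij_betw_nat_finite[OF fin] by (auto simp: atLeast0LessThan)
  have "\<exists>a. col A j = lincomb a S" if "j < nc" for j
  proof -
    have "col A j \<in> set (cols A)" using that A by (auto simp: cols_def)
    with S(3) have "col A j \<in> span S" by blast
    from finite_in_span[OF fin _ this] SC obtain a where "lincomb a S = col A j" by auto
    then show ?thesis by metis
  qed
  then obtain a where a: "\<And>j. j < nc \<Longrightarrow> col A j = lincomb (a j) S" by metis
  \<comment> \<open>\<open>f i\<close> lists the i-th entries of the spanning columns,
    \<open>g j\<close> the coefficients of column \<open>j\<close> in them.\<close>
  define f where "f i = Matrix.vec r (\<lambda>l. if l < card S then e l $ i else 0)" for i
  define g where "g j = Matrix.vec r (\<lambda>l. if l < card S then a j (e l) else 0)" for j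
  have "scalar_prod (f i) (g j) = A $$ (i, j)" if i: "i < n" and j: "j < nc" for i j
  proof -
    have "scalar_prod (f i) (g j) = (\<Sum>l<r. if l < card S then e l $ i * a j (e l) else 0)"
      unfolding scalar_prod_def f_def g_def atLeast0LessThan by (auto intro!: sum.cong)
    \<comment> \<open>The bound \<open>rank A \<le> r\<close> ensures that all spanning columns fit,
      so only padding is dropped.\<close>
    also have "\<dots> = (\<Sum>l<card S. a j (e l) * e l $ i)"
      using r S(2) by (intro sum.mono_neutral_cong_right) (auto simp: mult.commute)
    also have "\<dots> = (\<Sum>v\<in>S. a j v * v $ i)"
      by (rule sum.reindex_bij_betw[OF e])
    also have "\<dots> = col A j $ i"
      using lincomb_index[OF i SC, of "a j"] a[OF j] by simp
    finally show ?thesis using A i j by simp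
  qed
  then show thesis by (intro that[of f g]) (auto simp: f_def g_def)
qed

lemma represents_ssm_kernel:
  assumes "represents_ssm n H r V \<phi> \<psi> W" "t < n"
  shows "W t = (\<Sum>h=1..H. attention_weight \<phi> \<psi> h (Suc t) 1 *\<^sub>R V h)"
    (is "_ = ?R")
proof -
  have "W t *v v = ?R *v v" for v
  proof -
    \<comment> \<open>With its only possibly nonzero token at position 1, this input isolates lag
      \<open>t\<close> in the output at position \<open>Suc t\<close>, which is at most
      \<open>n\<close>.\<close>
    define x where "x j = (if j = 1 then v else 0)" for j :: nat
    have "attention_output n H V \<phi> \<psi> x (Suc t) = ?R *v v"
      using assms(2) unfolding attention_output_def x_def
      by (subst sum.remove[of _ 1]) (auto intro!: sum.neutral)
    moreover have "ssm_output W x (Suc t) = W t *v v"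
      unfolding ssm_output_def x_def
      by (subst sum.remove[of _ 1]) (auto intro!: sum.neutral)
    ultimately show ?thesis
      using assms unfolding represents_ssm_def by (metis Suc_leI atLeastAtMost_iff le_add1 plus_1_eq_Suc)
  qed
  then show ?thesis by (simp add: matrix_eq)
qed

lemma represents_ssm_dim_le:
  assumes "represents_ssm n H r V \<phi> \<psi> W"
  shows "dim (W ` {..<n}) \<le> H"
proof -
  have "W ` {..<n} \<subseteq> span (V ` {1..H})"
    using represents_ssm_kernel[OF assms]
    by (auto intro!: span_sum span_scale intro: span_base)
  then have "dim (W ` {..<n}) \<le> card (V ` {1..H})"
    by (rule dim_le_card) simp
  also have "\<dots> \<le> H" using card_image_le[of "{1..H}" V] by simp
  finally show ?thesis .
qed

text \<open>Head \<open>h\<close> takes the h-th Toeplitz matrix as its weights: the zeros above the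
  diagonal give causality, and combining the heads with values \<open>M h\<close> restores
  \<open>W (i - j)\<close>.\<close>

lemma represents_ssm_if_coordinates:
  assumes "is_coordinates n k W M c" and "k \<le> H"
    and r: "\<And>h. h \<in> {1..k} \<Longrightarrow> vec_space.rank n (coordinate_toeplitz n c h) \<le> r"
  shows "\<exists>V \<phi> \<psi>. represents_ssm n H r V \<phi> \<psi> W"
proof -
  have "\<exists>f g. (\<forall>i. f i \<in> carrier_vec r \<and> g i \<in> carrier_vec r) \<and>
      (\<forall>i<n. \<forall>j<n. scalar_prod (f i) (g j) = (if j \<le> i then c (i - j) h else 0))"
    if h: "h \<in> {1..k}" for h
  proof -
    have T: "coordinate_toeplitz n c h \<in> carrier_mat n n"
      by (simp add: coordinate_toeplitz_def)
    obtain f g where "\<And>i. f i \<in> carrier_vec r" "\<And>j. g j \<in> carrier_vec r"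
      "\<And>i j. i < n \<Longrightarrow> j < n \<Longrightarrow> scalar_prod (f i) (g j) = coordinate_toeplitz n c h $$ (i, j)"
      using vec_space.rank_factorization[OF T r[OF h]] by blast
    then show ?thesis
      by (intro exI[of _ f] exI[of _ g]) (auto simp: coordinate_toeplitz_def)
  qed
  then obtain f g where
    fg: "\<And>h i. h \<in> {1..k} \<Longrightarrow> f h i \<in> carrier_vec r \<and> g h i \<in> carrier_vec r"
    and prod: "\<And>h i j. h \<in> {1..k} \<Longrightarrow> i < n \<Longrightarrow> j < n \<Longrightarrow>
      scalar_prod (f h i) (g h j) = (if j \<le> i then c (i - j) h else 0)"
    by metis
  \<comment> \<open>Heads beyond \<open>k\<close> are switched off by zeros. The shift
    \<open>i - 1\<close> below turns positions 1, ..., n into matrix indices 0, ..., n-1.\<close>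
  define V where "V h = (if h \<le> k then M h else 0)" for h
  define \<phi> where "\<phi> h i = (if h \<le> k then f h (i - 1) else 0\<^sub>v r)" for h i
  define \<psi> where "\<psi> h i = (if h \<le> k then g h (i - 1) else 0\<^sub>v r)" for h i
  have weight: "attention_weight \<phi> \<psi> h i j = (if h \<le> k \<and> j \<le> i then c (i - j) h else 0)"
    if "h \<in> {1..H}" "i \<in> {1..n}" "j \<in> {1..n}" for h i j
    using that prod[of h "i - 1" "j - 1"]
    by (auto simp: attention_weight_def \<phi>_def \<psi>_def)
  have causal: "causal_linear_attention n H r \<phi> \<psi>"
    unfolding causal_linear_attention_def using fg weight by (auto simp: \<phi>_def \<psi>_def)
  have kernel: "(\<Sum>h=1..H. attention_weight \<phi> \<psi> h i j *\<^sub>R V h) = (if j \<le> i then W (i - j) else 0)"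
    if ij: "i \<in> {1..n}" "j \<in> {1..n}" for i j
  proof -
    have "(\<Sum>h=1..H. attention_weight \<phi> \<psi> h i j *\<^sub>R V h)
        = (\<Sum>h=1..k. (if j \<le> i then c (i - j) h else 0) *\<^sub>R M h)"
      using weight[OF _ ij] \<open>k \<le> H\<close>
      by (intro sum.mono_neutral_cong_right) (auto simp: V_def)
    \<comment> \<open>Positions in \<open>{1..n}\<close> differ by less than \<open>n\<close>, so
      the coordinates cover every lag that occurs.\<close>
    also have "\<dots> = (if j \<le> i then W (i - j) else 0)"
      using assms(1) ij by (auto simp: is_coordinates_def)
    finally show ?thesis .
  qed
  have "attention_output n H V \<phi> \<psi> x i = ssm_output W x i" if i: "i \<in> {1..n}" for x i
  proof -
    have "attention_output n H V \<phi> \<psi> x i = (\<Sum>j=1..n. (if j \<le> i then W (i - j) else 0) *v x j)"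
      unfolding attention_output_def using kernel[OF i] by (intro sum.cong) simp_all
    also have "\<dots> = ssm_output W x i"
      unfolding ssm_output_def using i by (intro sum.mono_neutral_cong_right) auto
    finally show ?thesis .
  qed
  with causal show ?thesis unfolding represents_ssm_def by blast
qed

lemma max_toeplitz_rank_ge:
  "h \<in> {1..k} \<Longrightarrow> vec_space.rank n (coordinate_toeplitz n c h) \<le> max_toeplitz_rank n k c"
  unfolding max_toeplitz_rank_def by (intro Max_ge) auto

lemma max_toeplitz_rank_le: "max_toeplitz_rank n k c \<le> n"
  unfolding max_toeplitz_rank_def
  by (auto intro!: vec_space.rank_le_nc simp: coordinate_toeplitz_def)

lemma is_basis_of_exists:
  assumes "subspace S"
  shows "\<exists>M. is_basis_of (dim S) M S"
proof -
  obtain B where B: "finite B" "independent B" "span B = S" "card B = dim S"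
    using basis_subspace_exists[OF assms] .
  obtain M where "bij_betw M {1..card B} B"
    using ex_bij_betw_nat_finite_1[OF B(1)] by auto
  with B show ?thesis
    unfolding is_basis_of_def bij_betw_def by (intro exI[of _ M]) auto
qed

theorem theorem4p4:
  fixes A :: "real ^ 'm ^ 'm" and B :: "real ^ 'd ^ 'm" and C :: "real ^ 'm ^ 'p"
    and W :: "nat \<Rightarrow> real ^ 'd ^ 'p" and k n H :: nat
  assumes W: "W = impulse_response A B C"
    and k: "k = interaction_rank W"
    and n: "span (W ` {..<n}) = span (range W)"
  shows "((\<exists>r V \<phi> \<psi>. represents_ssm n H r V \<phi> \<psi> W) \<longrightarrow> k \<le> H) \<and>
    (k \<le> H \<longrightarrow>
      (\<exists>r\<le>n. \<exists>V \<phi> \<psi>. represents_ssm n H r V \<phi> \<psi> W) \<and>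
      (\<forall>M c. is_basis_of k M (span (range W)) \<and> is_coordinates n k W M c \<longrightarrow>
        max_toeplitz_rank n k c \<le> n \<and>
        (\<exists>V \<phi> \<psi>. represents_ssm n H (max_toeplitz_rank n k c) V \<phi> \<psi> W)))"
proof (intro conjI impI allI)
  assume "\<exists>r V \<phi> \<psi>. represents_ssm n H r V \<phi> \<psi> W"
  then have "dim (W ` {..<n}) \<le> H" using represents_ssm_dim_le by blast
  \<comment> \<open>A set and its span have equal dimension, so by \<open>n\<close> the first
    \<open>n\<close> responses already have dimension \<open>k\<close>.\<close>
  then show "k \<le> H" using k n unfolding interaction_rank_def by (metis dim_span)
next
  assume "k \<le> H"
  have *: "\<exists>V \<phi> \<psi>. represents_ssm n H (max_toeplitz_rank n k c) V \<phi> \<psi> W"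
    if "is_coordinates n k W M c" for M c
    using represents_ssm_if_coordinates[OF that \<open>k \<le> H\<close>] max_toeplitz_rank_ge by blast
  show "\<exists>V \<phi> \<psi>. represents_ssm n H (max_toeplitz_rank n k c) V \<phi> \<psi> W"
    if "is_basis_of k M (span (range W)) \<and> is_coordinates n k W M c" for M c
    using * that by blast
  \<comment> \<open>Any one basis with its coordinates provides a head dimension
    \<open>r \<le> n\<close>, namely its maximal Toeplitz rank.\<close>
  obtain M where "is_basis_of k M (span (range W))"
    using is_basis_of_exists[OF subspace_span, of "range W"] k unfolding interaction_rank_def by blast
  then obtain c where "is_coordinates n k W M c"
    using is_coordinates_exists by blast
  with * show "\<exists>r\<le>n. \<exists>V \<phi> \<psi>. represents_ssm n H r V \<phi> \<psi> W"
    using max_toeplitz_rank_le by blast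
qed (rule max_toeplitz_rank_le)

end
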